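(* Let $\mathcal{T}=(t_{ijkl})\in\widehat{\mathcal{E}}_{4,3}$. Call a permutation $(i,j,k)$ of $(1,2,3)$ admissible if $$t_{iiij}t_{ijjj}=t_{iiik}t_{ikkk}=0,\qquad t_{jjjk}t_{jkkk}=-1,$$ and suppose that an admissible permutation exists. Then $\mathcal{T}$ is positive definite if and only if there is an admissible permutation $(i,j,k)$ for which one of the following conditions is satisfied. (a) $t_{iiij}=t_{ijjj}=t_{iiik}=t_{ikkk}=0$, and one of: (a$_1$) $t_{1123}=t_{1223}=t_{1233}=0$, $t_{jjkk}=1$ and $t_{iijj},t_{iikk}\in\{0,1\}$; (a$_2$) $t_{iijk}\in\{-1,1\}$, $t_{ijjk}=t_{ijkk}=0$ and $t_{1122}=t_{2233}=t_{1133}=1$. (b) $t_{iiij}\in\{-1,1\}$, $t_{ijjj}=t_{ikkk}=t_{iiik}=0$, and one of: (b$_1$) $t_{1123}=t_{1223}=t_{1233}=0$, $t_{iijj}=t_{jjkk}=1$ and $t_{iikk}\in\{0,1\}$; (b$_2$) $t_{ijkk}=0$ and $t_{iijk}t_{jkkk}=t_{ijjk}t_{iiij}t_{jkkk}=t_{1122}=t_{2233}=t_{1133}=1$. (c) $t_{ijjj}\in\{-1,1\}$, $t_{iiij}=t_{ikkk}=t_{iiik}=0$, $t_{1122}=t_{2233}=t_{1133}=1$, and one of: (c$_1$) $t_{iijk}=t_{ijkk}=0$ and $t_{ijjj}t_{jjjk}t_{ijjk}=1$; (c$_2$) $t_{ijjk}=t_{ijkk}=0$ and $t_{iijk}t_{jkkk}=1$.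 (d) $t_{ijjj}=t_{ikkk}=t_{ijjk}=t_{ijkk}=0$ and $t_{iijk}t_{iiij}t_{iiik}=t_{1122}=t_{2233}=t_{1133}=1$. (e) $t_{iiij}=t_{iiik}=0$, $t_{jjjk}=t_{1122}=t_{2233}=t_{1133}=1$, and one of: (e$_1$) $t_{ijjj}t_{ikkk}=-t_{iijk}=-t_{ijkk}t_{ijjj}=1$ and $t_{ijjk}=0$; (e$_2$) $t_{ijjj}t_{ikkk}=-t_{iijk}=-t_{ijjk}t_{ijjj}=-1$ and $t_{ijkk}=0$. (f) $t_{ijjj}=t_{iiik}=t_{iijk}=0$, $t_{ikkk}t_{jkkk}t_{ijkk}=t_{1122}=t_{2233}=t_{1133}=1$, and one of: (f$_1$) $t_{ijjk}=0$; (f$_2$) $t_{iiij}t_{ikkk}t_{jjjk}=-t_{ijjk}t_{ikkk}=-t_{ijkk}t_{iiij}=1$.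
   Context: A 4th order 3-dimensional real tensor $\mathcal{T}=(t_{ijkl})_{i,j,k,l\in\{1,2,3\}}$ is symmetric if its entries are invariant under all permutations of the four indices (so, e.g., $t_{ijjk}$ denotes the common value of all entries whose index multiset is $\{i,j,j,k\}$). $\widehat{\mathcal{E}}_{4,3}$ is the set of symmetric 4th order 3-dimensional tensors all of whose entries lie in $\{-1,0,1\}$ and whose diagonal entries satisfy $t_{1111}=t_{2222}=t_{3333}=1$. For $x\in\mathbb{R}^3$ put $\mathcal{T}x^4=\sum_{i,j,k,l=1}^3 t_{ijkl}x_ix_jx_kx_l$. $\mathcal{T}$ is positive definite if $\mathcal{T}x^4>0$ for all $x\in\mathbb{R}^3\setminus\{0\}$. *)

theory Defs
  imports "HOL-Analysis.Analysis"
begin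

text \<open>In the numeral type \<open>3\<close> the index \<open>3\<close> is the same element as \<open>0\<close>;
  its elements are exactly \<open>1\<close>, \<open>2\<close> and \<open>3\<close>.\<close>

type_synonym tensor43 = "3 \<Rightarrow> 3 \<Rightarrow> 3 \<Rightarrow> 3 \<Rightarrow> real"

definition symmetric_tensor :: "tensor43 \<Rightarrow> bool" where
  "symmetric_tensor T \<longleftrightarrow>
    (\<forall>(f :: nat \<Rightarrow> 3) p. p permutes {1..4} \<longrightarrow>
      T (f (p 1)) (f (p 2)) (f (p 3)) (f (p 4)) = T (f 1) (f 2) (f 3) (f 4))"

definition E_hat_43 :: "tensor43 set" where
  "E_hat_43 = {T. symmetric_tensor T \<and>
    (\<forall>i j k l. T i j k l \<in> {-1, 0, 1}) \<and>
    T 1 1 1 1 = 1 \<and> T 2 2 2 2 = 1 \<and> T 3 3 3 3 = 1}"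

definition tensor_form :: "tensor43 \<Rightarrow> real ^ 3 \<Rightarrow> real" where
  "tensor_form T x =
    (\<Sum>i\<in>UNIV. \<Sum>j\<in>UNIV. \<Sum>k\<in>UNIV. \<Sum>l\<in>UNIV. T i j k l * x $ i * x $ j * x $ k * x $ l)"

definition positive_definite_tensor :: "tensor43 \<Rightarrow> bool" where
  "positive_definite_tensor T \<longleftrightarrow> (\<forall>x. x \<noteq> 0 \<longrightarrow> tensor_form T x > 0)"

definition admissible :: "tensor43 \<Rightarrow> 3 \<Rightarrow> 3 \<Rightarrow> 3 \<Rightarrow> bool" where
  "admissible T i j k \<longleftrightarrow> distinct [i, j, k] \<and>
    T i i i j * T i j j j = 0 \<and> T i i i k * T i k k k = 0 \<and> T j j j k * T j k k k = -1"

end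

theory Submission
  imports Defs
begin

text \<open>
  Exchanging \<open>j\<close> and \<open>k\<close> one may assume \<open>t\<^sub>j\<^sub>j\<^sub>j\<^sub>k = 1\<close> and \<open>t\<^sub>j\<^sub>k\<^sub>k\<^sub>k = -1\<close>. The binary
  faces of the form force \<open>t\<^sub>j\<^sub>j\<^sub>k\<^sub>k = 1\<close> and leave six possibilities for each of the other two faces,
  hence 972 forms. A fixed list of 36 integer points refutes every one of them that is not
  listed in the theorem. Conversely, the order-4 rotation \<open>(x, y, z) \<mapsto> (x, z, -y)\<close> and increasing
  a coefficient of \<open>x\<^sup>2y\<^sup>2\<close> or \<open>x\<^sup>2z\<^sup>2\<close> reduce the listed forms to eleven, each of which exceeds a
  positive multiple of \<open>x\<^sup>4 + y\<^sup>4 + z\<^sup>4\<close> by an explicit sum of squares.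
\<close>

section \<open>Ternary quartics and the list of conditions\<close>

text \<open>The twelve coefficients are, in this order, \<open>t\<close> with indices \<open>iiij, ijjj, iiik, ikkk, jjjk, jkkk,
  iijj, iikk, jjkk, iijk, ijjk, ijkk\<close>, and \<open>(x, y, z)\<close> stands for the entries at \<open>i, j, k\<close>.\<close>

definition quartic ::
  "'a::comm_ring_1 \<Rightarrow> 'a \<Rightarrow> 'a \<Rightarrow> 'a \<Rightarrow> 'a \<Rightarrow> 'a \<Rightarrow> 'a \<Rightarrow> 'a \<Rightarrow>
    'a \<Rightarrow> 'a \<Rightarrow> 'a \<Rightarrow> 'a \<Rightarrow> 'a \<Rightarrow> 'a \<Rightarrow> 'a \<Rightarrow> 'a"
  where
  "quartic p q r s u v A B C D E F x y z =
    x^4 + y^4 + z^4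
    + 4 * (p * x^3 * y + q * x * y^3 + r * x^3 * z + s * x * z^3 + u * y^3 * z + v * y * z^3)
    + 6 * (A * x^2 * y^2 + B * x^2 * z^2 + C * y^2 * z^2)
    + 12 * (x * y * z) * (D * x + E * y + F * z)"

text \<open>The alternatives (a) to (f) in their order, with the three entries equal to 1 written as
  \<open>A\<close>, \<open>C\<close>, \<open>B\<close> in the order in which they appear after
  renaming indices, so that the final comparison is pure rewriting. The type is polymorphic so that
  the conditions can be evaluated on integers and applied to reals.\<close>

definition pd_conditions ::
  "'a::comm_ring_1 \<Rightarrow> 'a \<Rightarrow> 'a \<Rightarrow> 'a \<Rightarrow> 'a \<Rightarrow> 'a \<Rightarrow> 'a \<Rightarrow> 'a \<Rightarrow>
    'a \<Rightarrow> 'a \<Rightarrow> 'a \<Rightarrow> 'a \<Rightarrow> bool"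
  where
  "pd_conditions p q r s u v A B C D E F \<longleftrightarrow>
    (p = 0 \<and> q = 0 \<and> r = 0 \<and> s = 0 \<and>
       (D = 0 \<and> E = 0 \<and> F = 0 \<and> C = 1 \<and> (A = 0 \<or> A = 1) \<and> (B = 0 \<or> B = 1) \<or>
        (D = -1 \<or> D = 1) \<and> E = 0 \<and> F = 0 \<and> A = 1 \<and> C = 1 \<and> B = 1)) \<or>
    ((p = -1 \<or> p = 1) \<and> q = 0 \<and> s = 0 \<and> r = 0 \<and>
       (D = 0 \<and> E = 0 \<and> F = 0 \<and> A = 1 \<and> C = 1 \<and> (B = 0 \<or> B = 1) \<or>
        F = 0 \<and> D * v = 1 \<and> E * p * v = 1 \<and> A = 1 \<and> C = 1 \<and> B = 1)) \<or>
    ((q = -1 \<or> q = 1) \<and> p = 0 \<and> s = 0 \<and> r = 0 \<and> A = 1 \<and> C = 1 \<and> B = 1 \<and>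
       (D = 0 \<and> F = 0 \<and> q * u * E = 1 \<or> E = 0 \<and> F = 0 \<and> D * v = 1)) \<or>
    (q = 0 \<and> s = 0 \<and> E = 0 \<and> F = 0 \<and> D * p * r = 1 \<and> A = 1 \<and> C = 1 \<and> B = 1) \<or>
    (p = 0 \<and> r = 0 \<and> u = 1 \<and> A = 1 \<and> C = 1 \<and> B = 1 \<and>
       (q * s = 1 \<and> - D = 1 \<and> - (F * q) = 1 \<and> E = 0 \<or>
        q * s = -1 \<and> - D = -1 \<and> - (E * q) = -1 \<and> F = 0)) \<or>
    (q = 0 \<and> r = 0 \<and> D = 0 \<and> s * v * F = 1 \<and> A = 1 \<and> C = 1 \<and> B = 1 \<and>
       (E = 0 \<or> p * s * u = 1 \<and> - (E * s) = 1 \<and> - (F * p) = 1))"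

definition pos_form ::
  "real \<Rightarrow> real \<Rightarrow> real \<Rightarrow> real \<Rightarrow> real \<Rightarrow> real \<Rightarrow> real \<Rightarrow> real \<Rightarrow>
    real \<Rightarrow> real \<Rightarrow> real \<Rightarrow> real \<Rightarrow> bool"
  where
  "pos_form p q r s u v A B C D E F \<longleftrightarrow>
    (\<forall>x y z. (x, y, z) \<noteq> (0, 0, 0) \<longrightarrow> 0 < quartic p q r s u v A B C D E F x y z)"

section \<open>Symmetries, monotonicity and the positivity criterion\<close>

lemma pos_form_swap: "pos_form p q r s u v A B C D E F \<Longrightarrow> pos_form r s p q v u B A C D F E"
proof -
  have "quartic r s p q v u B A C D F E x y z = quartic p q r s u v A B C D E F x z y" for x y z
    by (simp add: quartic_def algebra_simps)
  then show "pos_form p q r s u v A B C D E F \<Longrightarrow> pos_form r s p q v u B A C D F E"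
    by (auto simp: pos_form_def)
qed

text \<open>Substituting -y for y negates exactly the coefficients of monomials odd in y. This
  exchanges the cases \<open>u = 1\<close>, \<open>v = -1\<close> and \<open>u = -1\<close>,
  \<open>v = 1\<close>.\<close>

lemma pos_form_flip_y:
  assumes "pos_form (- p) (- q) r s (- u) (- v) A B C (- D) E (- F)"
  shows "pos_form p q r s u v A B C D E F"
proof -
  have "quartic p q r s u v A B C D E F x y z
      = quartic (- p) (- q) r s (- u) (- v) A B C (- D) E (- F) x (- y) z" for x y z
    by (simp add: quartic_def algebra_simps)
  then show ?thesis
    using assms by (simp add: pos_form_def)
qed

lemma pos_form_mono:
  assumes "pos_form p q r s u v A B C D E F" "A \<le> A'" "B \<le> B'"
  shows "pos_form p q r s u v A' B' C D E F"
proof -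
  have "quartic p q r s u v A' B' C D E F x y z
      = quartic p q r s u v A B C D E F x y z + 6 * ((A' - A) * (x * y)^2 + (B' - B) * (x * z)^2)"
    for x y z
    by (simp add: quartic_def algebra_simps)
  then show ?thesis
    using assms by (auto simp: pos_form_def intro!: add_pos_nonneg)
qed

text \<open>Here \<open>g\<close> is a sum of squares and may vanish away from the origin; the
  margin \<open>e\<close> times the sum of fourth powers makes the inequality strict. The factor
  \<open>N\<close> clears denominators.\<close>

lemma pos_formI:
  assumes eq: "\<And>x y z. N * quartic p q r s u v A B C D E F x y z = e * (x^4 + y^4 + z^4) + g x y z"
    and "\<And>x y z. 0 \<le> g x y z" "0 < e" "0 < N"
  shows "pos_form p q r s u v A B C D E F"
  unfolding pos_form_def
proof (intro allI impI)
  fix x y z :: real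
  assume "(x, y, z) \<noteq> (0, 0, 0)"
  then have "0 < x^4 \<or> 0 < y^4 \<or> 0 < z^4"
    by (auto simp: zero_less_power_eq)
  moreover have "0 \<le> x^4" "0 \<le> y^4" "0 \<le> z^4"
    by simp_all
  ultimately have "0 < x^4 + y^4 + z^4"
    by linarith
  then have "0 < e * (x^4 + y^4 + z^4) + g x y z"
    using assms by (simp add: add_pos_nonneg)
  then show "0 < quartic p q r s u v A B C D E F x y z"
    using eq[of x y z] \<open>0 < N\<close> by (metis zero_less_mult_pos)
qed

section \<open>Sum-of-squares certificates\<close>

text \<open>The sums of squares below are LDL decompositions of rational Gram matrices found by semidefinite
  programming.\<close>

lemma pos_form_a1: "pos_form 0 0 0 0 1 (- 1) 0 0 1 0 0 0"
proof (rule pos_formI)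
  show "3 * quartic 0 0 0 0 1 (- 1) 0 0 1 0 0 0 x y z
      = 1 * (x^4 + y^4 + z^4)
        + (2 * (x^2)^2
        + 2 * (y^2 - z^2 + 3 * y * z)^2
        + 4 * (y * z)^2)" for x y z :: real
    unfolding quartic_def by algebra
qed auto

lemma pos_form_a2: "pos_form 0 0 0 0 1 (- 1) 1 1 1 1 0 0"
proof (rule pos_formI)
  show "12 * quartic 0 0 0 0 1 (- 1) 1 1 1 1 0 0 x y z
      = 4 * (x^4 + y^4 + z^4)
        + (2 * (x^2 + 2 * y^2 - 2 * z^2 + 6 * y * z)^2
        + 16 * (y * z)^2
        + 6 * (x^2)^2
        + 5 * (3 * x * y + 4 * x * z)^2
        + 19 * (x * y)^2)" for x y z :: real
    unfolding quartic_def by algebra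
qed auto

lemma pos_form_b1: "pos_form 1 0 0 0 1 (- 1) 1 0 1 0 0 0"
proof (rule pos_formI)
  show "3 * quartic 1 0 0 0 1 (- 1) 1 0 1 0 0 0 x y z
      = 1 * (x^4 + y^4 + z^4)
        + (2 * (x^2 + 3 * x * y)^2
        + 2 * (y^2 - z^2 + 3 * y * z)^2
        + 4 * (y * z)^2)" for x y z :: real
    unfolding quartic_def by algebra
qed auto

lemma pos_form_b2: "pos_form 1 0 0 0 1 (- 1) 1 1 1 (- 1) (- 1) 0"
proof (rule pos_formI)
  show "18291000 * quartic 1 0 0 0 1 (- 1) 1 1 1 (- 1) (- 1) 0 x y z
      = 91455 * (x^4 + y^4 + z^4)
        + (914550 * (3 * y^2 + 7 * x * y - 10 * x * z + 2 * y * z)^2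
        + 10050 * (40 * x^2 - 21 * y^2 + 20 * z^2 + 91 * x * y - 104 * y * z)^2
        + 8710 * (9 * x^2 - 21 * y^2 + 36 * z^2 - 50 * y * z)^2
        + 35 * (201 * x^2 + 134 * y^2 - 244 * z^2)^2
        + 871 * (35 * y^2 - 8 * z^2)^2
        + 751881 * (z^2)^2)" for x y z :: real
    unfolding quartic_def by algebra
qed auto

lemma pos_form_c2: "pos_form 0 1 0 0 1 (- 1) 1 1 1 (- 1) 0 0"
proof (rule pos_formI)
  show "13884000 * quartic 0 1 0 0 1 (- 1) 1 1 1 (- 1) 0 0 x y z
      = 92560 * (x^4 + y^4 + z^4)
        + (427200 * (3 * y^2 + 11 * x * y - 13 * x * z - y * z)^2
        + 4272 * (32 * y^2 - 13 * z^2 + 100 * x * y + 50 * y * z)^2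
        + 86775 * (8 * x^2 - 8 * y^2 + 9 * z^2 - 32 * y * z)^2
        + 4628 * (2 * y^2 - 33 * z^2)^2
        + 260 * (178 * x^2 - 15 * z^2)^2
        + 942305 * (z^2)^2)" for x y z :: real
    unfolding quartic_def by algebra
qed auto

text \<open>The four sign solutions of \<open>D * p * r = 1\<close> form a single rotation orbit, so
  one certificate suffices for (d).\<close>

lemma pos_form_d: "pos_form 1 0 1 0 1 (- 1) 1 1 1 1 0 0"
proof (rule pos_formI)
  show "3 * quartic 1 0 1 0 1 (- 1) 1 1 1 1 0 0 x y z
      = 1 * (x^4 + y^4 + z^4)
        + (2 * (y^2 - z^2 + 3 * y * z)^2
        + 2 * (x^2 + 3 * x * y + 3 * x * z)^2
        + 4 * (y * z)^2)" for x y z :: real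
    unfolding quartic_def by algebra
qed auto

text \<open>This is an (e1) form; a quarter turn gives \<open>q = -1\<close>, \<open>s = 1\<close>,
  \<open>D = 1\<close>, \<open>E = -1\<close>, \<open>F = 0\<close>, which is an (e2) form.\<close>

lemma pos_form_e: "pos_form 0 1 0 1 1 (- 1) 1 1 1 (- 1) 0 (- 1)"
proof (rule pos_formI)
  show "68544 * quartic 0 1 0 1 1 (- 1) 1 1 1 (- 1) 0 (- 1) x y z
      = 5712 * (x^4 + y^4 + z^4)
        + (2856 * (4 * y^2 - 4 * z^2 + 10 * x * y - 12 * x * z + 9 * y * z)^2
        + 204 * (4 * y^2 + 2 * z^2 + 28 * x * y - 21 * y * z)^2
        + 48 * (21 * x^2 - 17 * y^2 + 9 * z^2 - 63 * y * z)^2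
        + 28 * (20 * x^2 - 6 * z^2 - 9 * y * z)^2
        + 119 * (16 * x^2 - 3 * z^2)^2
        + 10353 * (z^2)^2)" for x y z :: real
    unfolding quartic_def by algebra
qed auto

text \<open>A quarter turn gives the (c1) form with \<open>q = E = -1\<close>, so (c1) is covered
  here too.\<close>

lemma pos_form_f1_zero: "pos_form 0 0 0 1 1 (- 1) 1 1 1 0 0 (- 1)"
proof (rule pos_formI)
  show "3 * quartic 0 0 0 1 1 (- 1) 1 1 1 0 0 (- 1) x y z
      = 1 * (x^4 + y^4 + z^4)
        + (2 * (y^2 - z^2 - 3 * x * z + 3 * y * z)^2
        + 2 * (x^2)^2
        + 2 * (3 * x * y + y * z)^2
        + 2 * (y * z)^2)" for x y z :: real
    unfolding quartic_def by algebra
qed auto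

text \<open>A half turn negates \<open>p\<close>, \<open>s\<close> and \<open>F\<close> together.
  Hence (f1) splits into three orbits by the value of \<open>p * s\<close>, and \<open>s = 1\<close>
  may be assumed in each.\<close>

lemma pos_form_f1_pos: "pos_form 1 0 0 1 1 (- 1) 1 1 1 0 0 (- 1)"
proof (rule pos_formI)
  show "2268 * quartic 1 0 0 1 1 (- 1) 1 1 1 0 0 (- 1) x y z
      = 189 * (x^4 + y^4 + z^4)
        + (168 * (3 * y^2 - 3 * z^2 + x * y - 9 * x * z + 9 * y * z)^2
        + 7 * (9 * y^2 - 8 * x * y)^2
        + 756 * (x^2 + 2 * x * y + 2 * y * z)^2
        + 7 * (9 * z^2 + 8 * x * y)^2
        + 27 * (7 * x^2 + 16 * x * y)^2
        + 2608 * (x * y)^2)" for x y z :: real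
    unfolding quartic_def by algebra
qed auto

lemma pos_form_f1_neg: "pos_form (- 1) 0 0 1 1 (- 1) 1 1 1 0 0 (- 1)"
proof (rule pos_formI)
  show "10792320 * quartic (- 1) 0 0 1 1 (- 1) 1 1 1 0 0 (- 1) x y z
      = 1349040 * (x^4 + y^4 + z^4)
        + (112420 * (6 * y^2 - 8 * z^2 - 2 * x * y - 24 * x * z + 23 * y * z)^2
        + 89936 * (5 * z^2 - 10 * x * y - 2 * y * z)^2
        + 84315 * (8 * y^2 + 2 * x * y + 9 * y * z)^2
        + 192720 * (7 * x^2 - 16 * x * y - 4 * y * z)^2
        + 9 * (790 * x * y + 803 * y * z)^2
        + 20160 * (x * y)^2)" for x y z :: real
    unfolding quartic_def by algebra
qed auto

lemma pos_form_f2: "pos_form 1 0 0 1 1 (- 1) 1 1 1 0 (- 1) (- 1)"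
proof (rule pos_formI)
  show "8352 * quartic 1 0 0 1 1 (- 1) 1 1 1 0 (- 1) (- 1) x y z
      = 261 * (x^4 + y^4 + z^4)
        + (87 * (9 * y^2 - 8 * z^2 - 4 * x * y - 24 * x * z + 24 * y * z)^2
        + 1044 * (x^2 + y^2 + 3 * x * y - 2 * y * z)^2
        + 522 * (3 * x^2 + 8 * x * y - 4 * y * z)^2
        + 3 * (29 * z^2 - 32 * x * y)^2
        + 29 * (9 * x^2 + 4 * x * y)^2
        + 292 * (x * y)^2)" for x y z :: real
    unfolding quartic_def by algebra
qed auto

section \<open>Sufficiency of the conditions\<close>

text \<open>The swap turns \<open>u = 1\<close>, \<open>v = -1\<close> into \<open>u = -1\<close>,
  \<open>v = 1\<close>, and the sign change of y restores it, so the composite stays within the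
  normalised forms.\<close>

lemma pos_form_rotate:
  "pos_form p q r s 1 (- 1) A B C D E F \<Longrightarrow> pos_form (- r) (- s) p q 1 (- 1) B A C (- D) F (- E)"
  by (drule pos_form_swap, rule pos_form_flip_y) simp

text \<open>Raising \<open>A\<close> or \<open>B\<close> from 0 to 1 gives the remaining choices in
  (a1) and (b1).\<close>

lemmas pos_form_base =
  pos_form_a1 pos_form_a1[THEN pos_form_mono[where A' = 1 and B' = 0], simplified]
  pos_form_a1[THEN pos_form_mono[where A' = 0 and B' = 1], simplified]
  pos_form_a1[THEN pos_form_mono[where A' = 1 and B' = 1], simplified]
  pos_form_a2 pos_form_b1 pos_form_b1[THEN pos_form_mono[where A' = 1 and B' = 1], simplified]
  pos_form_b2 pos_form_c2 pos_form_d pos_form_e pos_form_f1_zero pos_form_f1_pos pos_form_f1_neg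
  pos_form_f2

text \<open>The rotation has order 4, so three iterations exhaust every orbit.\<close>

lemmas pos_form_rotate1 = pos_form_base[THEN pos_form_rotate, simplified]
lemmas pos_form_rotate2 = pos_form_rotate1[THEN pos_form_rotate, simplified]
lemmas pos_form_rotate3 = pos_form_rotate2[THEN pos_form_rotate, simplified]

lemma pos_form_if_pd_conditions_normalised:
  assumes cond: "pd_conditions p q r s 1 (- 1) A B C D E F"
    and mem: "p \<in> {- 1, 0, 1}" "q \<in> {- 1, 0, 1}" "r \<in> {- 1, 0, 1}" "s \<in> {- 1, 0, 1}"
      "D \<in> {- 1, 0, 1}" "E \<in> {- 1, 0, 1}" "F \<in> {- 1, 0, 1}"
  shows "pos_form p q r s 1 (- 1) A B C D E F"
proof -
  note pos = pos_form_base pos_form_rotate1 pos_form_rotate2 pos_form_rotate3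
  show ?thesis
    using cond unfolding pd_conditions_def
  proof (elim disjE, goal_cases)
    case 1
    then show ?case by (auto simp: pos)
  next
    case 2
    then show ?case by (auto simp: pos)
  next
    case 3
    then show ?case by (auto simp: pos minus_equation_iff[of _ 1])
  next
    case 4
    \<comment> \<open>From here on the conditions fix some coefficients only through products, so
      their values in {-1, 0, 1} are enumerated.\<close>
    then show ?case using mem(1,3,5) by (auto simp: pos)
  next
    case 5
    then show ?case using mem(2,4,6,7) by (auto simp: pos)
  next
    case 6
    then show ?case using mem(1,4,6,7) by (auto simp: pos)
  qed
qed

text \<open>All alternatives survive the sign change except (e), which demands \<open>u = 1\<close>.
  It is vacuous in the hypothesis, whereas the converse implication would fail on it.\<close>

lemma pd_conditions_flip_y:
  "pd_conditions p q r s (- 1) 1 A B C D E F \<Longrightarrow>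
    pd_conditions (- p) (- q) r s 1 (- 1) A B C (- D) E (- F :: real)"
  unfolding pd_conditions_def by (elim disjE conjE) simp_all

lemma pos_form_if_pd_conditions:
  assumes "pd_conditions p q r s u v A B C D E F" "u * v = - 1" "u \<in> {- 1, 0, 1}"
    and mem: "p \<in> {- 1, 0, 1}" "q \<in> {- 1, 0, 1}" "r \<in> {- 1, 0, 1}" "s \<in> {- 1, 0, 1}"
      "D \<in> {- 1, 0, 1}" "E \<in> {- 1, 0, 1}" "F \<in> {- 1, 0, 1}"
  shows "pos_form p q r s u v A B C D E F"
proof -
  consider "u = 1" "v = - 1" | "u = - 1" "v = 1"
    using assms(2,3) by auto
  then show ?thesis
  proof cases
    case 1
    then show ?thesis
      using assms(1) mem pos_form_if_pd_conditions_normalised by simp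
  next
    case 2
    then have "pos_form (- p) (- q) r s 1 (- 1) A B C (- D) E (- F)"
      using assms(1) mem
      by (intro pos_form_if_pd_conditions_normalised pd_conditions_flip_y) auto
    then show ?thesis
      using 2 pos_form_flip_y[of p q r s u v A B C D E F] by simp
  qed
qed

section \<open>Necessity of the conditions\<close>

text \<open>The triples \<open>(p, q, A)\<close> over {-1, 0, 1} with \<open>p * q = 0\<close> for
  which the form is positive at (1, 1, 0) and (1, -1, 0), that is, 2 + 6A > 4|p + q|. The same list
  serves \<open>(r, s, B)\<close>.\<close>

definition face_coeffs :: "(int \<times> int \<times> int) list" where
  "face_coeffs = [(0, 0, 0), (0, 0, 1), (- 1, 0, 1), (1, 0, 1), (0, - 1, 1), (0, 1, 1)]"

text \<open>One representative per rotation orbit, found by a greedy search over the points of maximum norm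
  at most 8.\<close>

definition witnesses :: "(int \<times> int \<times> int) list" where
  "witnesses = concat (map (\<lambda>(x, y, z). [(x, y, z), (x, z, - y), (x, - y, - z), (x, - z, y)])
    [(2, - 5, 2), (2, - 1, - 1), (2, - 7, 1), (3, - 3, - 2), (6, - 2, - 1), (2, - 8, 3),
     (4, - 2, 1), (2, - 4, 3), (4, - 4, 3)])"

text \<open>An exhaustive check of 6 * 6 * 27 = 972 integer cases, quantified over explicit lists so
  that it can be evaluated. The second disjunct is needed because the conditions are not symmetric
  in j and k: (b), for instance, has \<open>p\<close> nonzero and \<open>r = 0\<close>.\<close>

lemma pd_conditions_if_pos_witnesses:
  "\<forall>(p, q, A) \<in> set face_coeffs. \<forall>(r, s, B) \<in> set face_coeffs.
   \<forall>D \<in> set [- 1, 0, 1]. \<forall>E \<in> set [- 1, 0, 1]. \<forall>F \<in> set [- 1, 0, 1].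
    (\<forall>(x, y, z) \<in> set witnesses. 0 < quartic p q r s 1 (- 1) A B 1 D E F x y z) \<longrightarrow>
    pd_conditions p q r s 1 (- 1) A B 1 D E F \<or> pd_conditions r s p q (- 1) 1 B A 1 D F E"
  by code_simp

lemma zero_notin_witnesses: "(0, 0, 0) \<notin> set witnesses"
  by (simp add: witnesses_def)

lemma quartic_of_int:
  "quartic (of_int p) (of_int q) (of_int r) (of_int s) (of_int u) (of_int v) (of_int A) (of_int B)
      (of_int C) (of_int D) (of_int E) (of_int F) (of_int x) (of_int y) (of_int z)
    = of_int (quartic p q r s u v A B C D E F x y z)"
  by (simp add: quartic_def)

lemma pd_conditions_of_int:
  "pd_conditions (of_int p :: 'a :: {comm_ring_1, ring_char_0}) (of_int q) (of_int r) (of_int s)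
      (of_int u) (of_int v) (of_int A) (of_int B) (of_int C) (of_int D) (of_int E) (of_int F)
    \<longleftrightarrow> pd_conditions p q r s u v A B C D E F"
proof -
  have "of_int a = (- 1 :: 'a) \<longleftrightarrow> a = - 1" for a
    using of_int_eq_iff[of a "- 1", where ?'a = 'a] by simp
  then show ?thesis
    unfolding pd_conditions_def by (simp flip: of_int_mult of_int_minus)
qed

lemma pd_conditions_if_pos_form_int:
  fixes p q r s A B C D E F :: int
  assumes pos: "pos_form p q r s 1 (- 1) A B C D E F" and zero: "p = 0 \<or> q = 0" "r = 0 \<or> s = 0"
    and mem: "p \<in> {- 1, 0, 1}" "q \<in> {- 1, 0, 1}" "r \<in> {- 1, 0, 1}" "s \<in> {- 1, 0, 1}"
      "A \<in> {- 1, 0, 1}" "B \<in> {- 1, 0, 1}" "C \<in> {- 1, 0, 1}" "D \<in> {- 1, 0, 1}"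
      "E \<in> {- 1, 0, 1}" "F \<in> {- 1, 0, 1}"
  shows "pd_conditions p q r s 1 (- 1) A B C D E F \<or> pd_conditions r s p q (- 1) 1 B A C D F E"
proof -
  have pos': "0 < quartic p q r s 1 (- 1) A B C D E F x y z"
    if "(x, y, z) \<noteq> (0, 0, 0)" for x y z :: int
  proof -
    have "(real_of_int x, real_of_int y, real_of_int z) \<noteq> (0, 0, 0)"
      using that by simp
    then have "0 < quartic (real_of_int p) q r s (of_int 1) (of_int (- 1)) A B C D E F x y z"
      using pos unfolding pos_form_def by simp
    then show ?thesis
      unfolding quartic_of_int by simp
  qed
  \<comment> \<open>The value at (0, -2, 1) is 24C - 7.\<close>
  have "C = 1"
    using pos'[of 0 "- 2" 1] mem(7) by (auto simp: quartic_def)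
  moreover have "(p, q, A) \<in> set face_coeffs"
    using pos'[of 1 1 0] pos'[of 1 "- 1" 0] mem(1,2,5) zero(1)
    by (auto simp: quartic_def face_coeffs_def)
  moreover have "(r, s, B) \<in> set face_coeffs"
    using pos'[of 1 0 1] pos'[of 1 0 "- 1"] mem(3,4,6) zero(2)
    by (auto simp: quartic_def face_coeffs_def)
  moreover have "\<forall>(x, y, z) \<in> set witnesses. 0 < quartic p q r s 1 (- 1) A B C D E F x y z"
  proof clarify
    fix x y z
    assume "(x, y, z) \<in> set witnesses"
    then show "0 < quartic p q r s 1 (- 1) A B C D E F x y z"
      using zero_notin_witnesses by (intro pos') metis
  qed
  moreover have "D \<in> set [- 1, 0, 1]" "E \<in> set [- 1, 0, 1]" "F \<in> set [- 1, 0, 1]"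
    using mem by simp_all
  ultimately show ?thesis
    using pd_conditions_if_pos_witnesses by blast
qed

text \<open>Reduces to the integer statement, since the floor is exact on {-1, 0, 1}.\<close>

lemma pd_conditions_if_pos_form:
  assumes pos: "pos_form p q r s 1 (- 1) A B C D E F" and zero: "p * q = 0" "r * s = 0"
    and mem: "p \<in> {- 1, 0, 1}" "q \<in> {- 1, 0, 1}" "r \<in> {- 1, 0, 1}" "s \<in> {- 1, 0, 1}"
      "A \<in> {- 1, 0, 1}" "B \<in> {- 1, 0, 1}" "C \<in> {- 1, 0, 1}" "D \<in> {- 1, 0, 1}"
      "E \<in> {- 1, 0, 1}" "F \<in> {- 1, 0, 1}"
  shows "pd_conditions p q r s 1 (- 1) A B C D E F \<or> pd_conditions r s p q (- 1) 1 B A C D F E"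
proof -
  have int: "real_of_int \<lfloor>a\<rfloor> = a" "\<lfloor>a\<rfloor> \<in> {- 1, 0, 1}" if "a \<in> {- 1, 0, 1}" for a :: real
  proof -
    have "\<exists>b::int \<in> {- 1, 0, 1}. a = of_int b"
      using that by auto
    then obtain b :: int where "b \<in> {- 1, 0, 1}" "a = of_int b" ..
    then show "real_of_int \<lfloor>a\<rfloor> = a" "\<lfloor>a\<rfloor> \<in> {- 1, 0, 1}"
      by simp_all
  qed
  note eq = mem[THEN int(1)]
  have "pd_conditions \<lfloor>p\<rfloor> \<lfloor>q\<rfloor> \<lfloor>r\<rfloor> \<lfloor>s\<rfloor> 1 (- 1) \<lfloor>A\<rfloor> \<lfloor>B\<rfloor> \<lfloor>C\<rfloor> \<lfloor>D\<rfloor> \<lfloor>E\<rfloor> \<lfloor>F\<rfloor>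
      \<or> pd_conditions \<lfloor>r\<rfloor> \<lfloor>s\<rfloor> \<lfloor>p\<rfloor> \<lfloor>q\<rfloor> (- 1) 1 \<lfloor>B\<rfloor> \<lfloor>A\<rfloor> \<lfloor>C\<rfloor> \<lfloor>D\<rfloor> \<lfloor>F\<rfloor> \<lfloor>E\<rfloor>"
  proof (rule pd_conditions_if_pos_form_int)
    show "pos_form \<lfloor>p\<rfloor> \<lfloor>q\<rfloor> \<lfloor>r\<rfloor> \<lfloor>s\<rfloor> 1 (- 1) \<lfloor>A\<rfloor> \<lfloor>B\<rfloor> \<lfloor>C\<rfloor> \<lfloor>D\<rfloor> \<lfloor>E\<rfloor> \<lfloor>F\<rfloor>"
      using pos by (simp only: eq)
    show "\<lfloor>p\<rfloor> = 0 \<or> \<lfloor>q\<rfloor> = 0" "\<lfloor>r\<rfloor> = 0 \<or> \<lfloor>s\<rfloor> = 0"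
      using zero by auto
  qed (fact mem[THEN int(2)])+
  then show ?thesis
    using pd_conditions_of_int[where ?'a = real, of "\<lfloor>p\<rfloor>" "\<lfloor>q\<rfloor>" "\<lfloor>r\<rfloor>" "\<lfloor>s\<rfloor>" 1 "- 1"
        "\<lfloor>A\<rfloor>" "\<lfloor>B\<rfloor>" "\<lfloor>C\<rfloor>" "\<lfloor>D\<rfloor>" "\<lfloor>E\<rfloor>" "\<lfloor>F\<rfloor>"]
      pd_conditions_of_int[where ?'a = real, of "\<lfloor>r\<rfloor>" "\<lfloor>s\<rfloor>" "\<lfloor>p\<rfloor>" "\<lfloor>q\<rfloor>" "- 1" 1
        "\<lfloor>B\<rfloor>" "\<lfloor>A\<rfloor>" "\<lfloor>C\<rfloor>" "\<lfloor>D\<rfloor>" "\<lfloor>F\<rfloor>" "\<lfloor>E\<rfloor>"]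
    by (simp only: eq of_int_1 of_int_minus)
qed

section \<open>From symmetric tensors to quartics\<close>

text \<open>Adjacent transpositions generate all permutations; used as ordered rewrite rules, these
  equations bring all entries with the same index multiset to one normal form.\<close>

lemma symmetric_tensor_swaps:
  assumes "symmetric_tensor T"
  shows "T b a c d = T a b c d" "T a c b d = T a b c d" "T a b d c = T a b c d"
proof -
  define f where "f = (\<lambda>n::nat. if n = 1 then a else if n = 2 then b else if n = 3 then c else d)"
  have *: "T (f (Transposition.transpose m n 1)) (f (Transposition.transpose m n 2))
      (f (Transposition.transpose m n 3)) (f (Transposition.transpose m n 4))
      = T (f 1) (f 2) (f 3) (f 4)" if "m \<in> {1..4}" "n \<in> {1..4}" for m n :: nat
    using assms permutes_swap_id[OF that] unfolding symmetric_tensor_def by blast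
  show "T b a c d = T a b c d" using *[of 1 2] by (simp add: f_def Transposition.transpose_def)
  show "T a c b d = T a b c d" using *[of 2 3] by (simp add: f_def Transposition.transpose_def)
  show "T a b d c = T a b c d" using *[of 3 4] by (simp add: f_def Transposition.transpose_def)
qed

lemma UNIV_3_distinct:
  assumes "distinct [i, j, k :: 3]"
  shows "UNIV = {i, j, k}"
  using assms by (intro card_subset_eq[symmetric]) (auto simp: card_insert_if)

text \<open>The coefficients 1, 4, 6 and 12 of \<open>quartic\<close> count the index tuples with a
  given multiset.\<close>

lemma tensor_form_eq_quartic:
  assumes T: "T \<in> E_hat_43" and d: "distinct [i, j, k]"
  shows "tensor_form T x = quartic (T i i i j) (T i j j j) (T i i i k) (T i k k k)
    (T j j j k) (T j k k k) (T i i j j) (T i i k k) (T j j k k) (T i i j k) (T i j j k) (T i j k k)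
    (x $ i) (x $ j) (x $ k)"
proof -
  have sym: "symmetric_tensor T" using T by (simp add: E_hat_43_def)
  have diag: "T a a a a = 1" for a
    using T exhaust_3[of a] by (auto simp: E_hat_43_def)
  have sum: "(\<Sum>a\<in>UNIV. g a) = g i + g j + g k" for g :: "3 \<Rightarrow> real"
    using d by (simp add: UNIV_3_distinct[OF d] add.assoc)
  show ?thesis
    unfolding tensor_form_def sum quartic_def
    by (simp add: symmetric_tensor_swaps[OF sym] diag) algebra
qed

text \<open>Renaming the indices only permutes the three entries within each group, so conditions
  with fixed indices can be read in terms of i, j, k.\<close>

lemma symmetric_tensor_mixed_indices:
  assumes "symmetric_tensor T" "distinct [i, j, k]"
  shows "T 1 1 2 3 = 0 \<and> T 1 2 2 3 = 0 \<and> T 1 2 3 3 = 0 \<longleftrightarrow>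
      T i i j k = 0 \<and> T i j j k = 0 \<and> T i j k k = 0"
    and "T 1 1 2 2 = 1 \<and> T 2 2 3 3 = 1 \<and> T 1 1 3 3 = 1 \<longleftrightarrow>
      T i i j j = 1 \<and> T j j k k = 1 \<and> T i i k k = 1"
proof -
  have "(i, j, k) \<in> {(1,2,3), (1,3,2), (2,1,3), (2,3,1), (3,1,2), (3,2,1)}"
    using assms(2) exhaust_3[of i] exhaust_3[of j] exhaust_3[of k] by auto
  then show "T 1 1 2 3 = 0 \<and> T 1 2 2 3 = 0 \<and> T 1 2 3 3 = 0 \<longleftrightarrow>
      T i i j k = 0 \<and> T i j j k = 0 \<and> T i j k k = 0"
    and "T 1 1 2 2 = 1 \<and> T 2 2 3 3 = 1 \<and> T 1 1 3 3 = 1 \<longleftrightarrow>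
      T i i j j = 1 \<and> T j j k k = 1 \<and> T i i k k = 1"
    by (auto simp: symmetric_tensor_swaps[OF assms(1)])
qed

lemma positive_definite_iff_pos_form:
  assumes "T \<in> E_hat_43" "distinct [i, j, k]"
  shows "positive_definite_tensor T \<longleftrightarrow> pos_form (T i i i j) (T i j j j) (T i i i k) (T i k k k)
    (T j j j k) (T j k k k) (T i i j j) (T i i k k) (T j j k k) (T i i j k) (T i j j k) (T i j k k)"
    (is "_ \<longleftrightarrow> ?P")
proof
  assume pd: "positive_definite_tensor T"
  show ?P
    unfolding pos_form_def
  proof (intro allI impI)
    fix x y z :: real
    assume nz: "(x, y, z) \<noteq> (0, 0, 0)"
    define w :: "real ^ 3" where "w = (\<chi> a. if a = i then x else if a = j then y else z)"
    have w: "w $ i = x" "w $ j = y" "w $ k = z" using assms(2) by (auto simp: w_def)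
    then have "w \<noteq> 0" using nz by auto
    then have "0 < tensor_form T w" using pd by (simp add: positive_definite_tensor_def)
    then show "0 < quartic (T i i i j) (T i j j j) (T i i i k) (T i k k k)
      (T j j j k) (T j k k k) (T i i j j) (T i i k k) (T j j k k) (T i i j k) (T i j j k) (T i j k k) x y z"
      by (simp add: tensor_form_eq_quartic[OF assms] w)
  qed
next
  assume P: ?P
  show "positive_definite_tensor T"
    unfolding positive_definite_tensor_def
  proof (intro allI impI)
    fix w :: "real ^ 3"
    assume "w \<noteq> 0"
    then obtain a where "w $ a \<noteq> 0" by (auto simp: vec_eq_iff)
    moreover have "a \<in> {i, j, k}" using UNIV_3_distinct[OF assms(2)] by auto
    ultimately have "(w $ i, w $ j, w $ k) \<noteq> (0, 0, 0)" by auto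
    then show "0 < tensor_form T w"
      using P by (simp add: tensor_form_eq_quartic[OF assms] pos_form_def)
  qed
qed

section \<open>Characterisation in terms of admissible permutations\<close>

theorem theorem3p9:
  fixes T :: "3 \<Rightarrow> 3 \<Rightarrow> 3 \<Rightarrow> 3 \<Rightarrow> real"
  assumes "T \<in> E_hat_43"
    and "\<exists>i j k. admissible T i j k"
  shows "positive_definite_tensor T \<longleftrightarrow>
    (\<exists>i j k. admissible T i j k \<and>
      (\<comment> \<open>(a)\<close>
       (T i i i j = 0 \<and> T i j j j = 0 \<and> T i i i k = 0 \<and> T i k k k = 0 \<and>
         ((T 1 1 2 3 = 0 \<and> T 1 2 2 3 = 0 \<and> T 1 2 3 3 = 0 \<and>
           T j j k k = 1 \<and> T i i j j \<in> {0, 1} \<and> T i i k k \<in> {0, 1}) \<or>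
          (T i i j k \<in> {-1, 1} \<and> T i j j k = 0 \<and> T i j k k = 0 \<and>
           T 1 1 2 2 = 1 \<and> T 2 2 3 3 = 1 \<and> T 1 1 3 3 = 1))) \<or>
       \<comment> \<open>(b)\<close>
       (T i i i j \<in> {-1, 1} \<and> T i j j j = 0 \<and> T i k k k = 0 \<and> T i i i k = 0 \<and>
         ((T 1 1 2 3 = 0 \<and> T 1 2 2 3 = 0 \<and> T 1 2 3 3 = 0 \<and>
           T i i j j = 1 \<and> T j j k k = 1 \<and> T i i k k \<in> {0, 1}) \<or>
          (T i j k k = 0 \<and> T i i j k * T j k k k = 1 \<and> T i j j k * T i i i j * T j k k k = 1 \<and>
           T 1 1 2 2 = 1 \<and> T 2 2 3 3 = 1 \<and> T 1 1 3 3 = 1))) \<or>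
       \<comment> \<open>(c)\<close>
       (T i j j j \<in> {-1, 1} \<and> T i i i j = 0 \<and> T i k k k = 0 \<and> T i i i k = 0 \<and>
         T 1 1 2 2 = 1 \<and> T 2 2 3 3 = 1 \<and> T 1 1 3 3 = 1 \<and>
         ((T i i j k = 0 \<and> T i j k k = 0 \<and> T i j j j * T j j j k * T i j j k = 1) \<or>
          (T i j j k = 0 \<and> T i j k k = 0 \<and> T i i j k * T j k k k = 1))) \<or>
       \<comment> \<open>(d)\<close>
       (T i j j j = 0 \<and> T i k k k = 0 \<and> T i j j k = 0 \<and> T i j k k = 0 \<and>
         T i i j k * T i i i j * T i i i k = 1 \<and>
         T 1 1 2 2 = 1 \<and> T 2 2 3 3 = 1 \<and> T 1 1 3 3 = 1) \<or>
       \<comment> \<open>(e)\<close>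
       (T i i i j = 0 \<and> T i i i k = 0 \<and> T j j j k = 1 \<and>
         T 1 1 2 2 = 1 \<and> T 2 2 3 3 = 1 \<and> T 1 1 3 3 = 1 \<and>
         ((T i j j j * T i k k k = 1 \<and> - T i i j k = 1 \<and> - (T i j k k * T i j j j) = 1 \<and>
           T i j j k = 0) \<or>
          (T i j j j * T i k k k = -1 \<and> - T i i j k = -1 \<and> - (T i j j k * T i j j j) = -1 \<and>
           T i j k k = 0))) \<or>
       \<comment> \<open>(f)\<close>
       (T i j j j = 0 \<and> T i i i k = 0 \<and> T i i j k = 0 \<and>
         T i k k k * T j k k k * T i j k k = 1 \<and>
         T 1 1 2 2 = 1 \<and> T 2 2 3 3 = 1 \<and> T 1 1 3 3 = 1 \<and>
         (T i j j k = 0 \<or>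
          (T i i i j * T i k k k * T j j j k = 1 \<and> - (T i j j k * T i k k k) = 1 \<and>
           - (T i j k k * T i i i j) = 1)))))"
proof -
  have sym: "symmetric_tensor T" and mem: "T a b c d \<in> {- 1, 0, 1}" for a b c d
    using assms(1) by (auto simp: E_hat_43_def)
  note swaps = symmetric_tensor_swaps[OF sym]
  let ?cond = "\<lambda>i j k. pd_conditions (T i i i j) (T i j j j) (T i i i k) (T i k k k)
    (T j j j k) (T j k k k) (T i i j j) (T i i k k) (T j j k k) (T i i j k) (T i j j k) (T i j k k)"
  have "positive_definite_tensor T \<longleftrightarrow> (\<exists>i j k. admissible T i j k \<and> ?cond i j k)"
  proof
    assume pd: "positive_definite_tensor T"
    \<comment> \<open>Exchanging j and k preserves admissibility and swaps the two entries with
      product -1, so the entry \<open>T j j j k\<close> can be taken to be 1.\<close>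
    obtain i j k where adm: "admissible T i j k" and u: "T j j j k = 1"
    proof -
      from assms(2) obtain i j k where ijk: "admissible T i j k" by blast
      then have "admissible T i k j"
        by (auto simp: admissible_def swaps mult.commute)
      moreover have "T j j j k = 1 \<or> T k k k j = 1"
        using ijk mem[of j j j k] mem[of k k k j] swaps by (auto simp: admissible_def)
      ultimately show ?thesis
        using that ijk by blast
    qed
    then have d: "distinct [i, j, k]" and v: "T j k k k = - 1"
      and zero: "T i i i j * T i j j j = 0" "T i i i k * T i k k k = 0"
      by (auto simp: admissible_def)
    \<comment> \<open>By symmetry of \<open>T\<close>, the second disjunct is
      \<open>?cond i k j\<close>, so the permutation sought is (i, j, k) or (i, k, j).\<close>
    have "?cond i j k \<or> pd_conditions (T i i i k) (T i k k k) (T i i i j) (T i j j j) (- 1) 1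
      (T i i k k) (T i i j j) (T j j k k) (T i i j k) (T i j k k) (T i j j k)"
      using positive_definite_iff_pos_form[OF assms(1) d] pd u v
      by (simp, intro pd_conditions_if_pos_form) (use zero mem in auto)
    moreover have "admissible T i k j"
      using adm by (auto simp: admissible_def swaps mult.commute)
    moreover have "T k k k j = - 1" "T k j j j = 1" "T k k j j = T j j k k"
        "T i i k j = T i i j k" "T i k k j = T i j k k" "T i k j j = T i j j k"
      using u v by (simp_all add: swaps)
    ultimately show "\<exists>i j k. admissible T i j k \<and> ?cond i j k"
      using adm by metis
  next
    assume "\<exists>i j k. admissible T i j k \<and> ?cond i j k"
    then obtain i j k where adm: "admissible T i j k" and cond: "?cond i j k" by blast
    have "pos_form (T i i i j) (T i j j j) (T i i i k) (T i k k k) (T j j j k) (T j k k k)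
      (T i i j j) (T i i k k) (T j j k k) (T i i j k) (T i j j k) (T i j k k)"
      using adm by (intro pos_form_if_pd_conditions cond mem) (simp add: admissible_def)
    then show "positive_definite_tensor T"
      using positive_definite_iff_pos_form[OF assms(1), of i j k] adm by (simp add: admissible_def)
  qed
  then show ?thesis
  proof (rule trans, intro ex_cong1 conj_cong refl, goal_cases)
    case (1 i j k)
    then have "distinct [i, j, k]" by (simp add: admissible_def)
    note idx = symmetric_tensor_mixed_indices[OF sym this]
    \<comment> \<open>After reassociating to the right, a group of three equations may be followed
      by further conjuncts; \<open>R\<close> stands for that tail.\<close>
    have idx_conj:
      "T 1 1 2 3 = 0 \<and> T 1 2 2 3 = 0 \<and> T 1 2 3 3 = 0 \<and> R \<longleftrightarrow>
        T i i j k = 0 \<and> T i j j k = 0 \<and> T i j k k = 0 \<and> R"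
      "T 1 1 2 2 = 1 \<and> T 2 2 3 3 = 1 \<and> T 1 1 3 3 = 1 \<and> R \<longleftrightarrow>
        T i i j j = 1 \<and> T j j k k = 1 \<and> T i i k k = 1 \<and> R" for R
      using idx by blast+
    show ?case
      by (simp only: pd_conditions_def idx idx_conj insert_iff empty_iff simp_thms conj_assoc
          disj_assoc)
  qed
qed

end
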